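(* Let $G$ be a finite simple graph with $|G|$ vertices and maximum degree $\Delta(G)$. If $\Delta(G)\geq \frac{2}{3}|G|-1$, then $a_{eq}(G)\leq \left\lceil\frac{\Delta(G)+1}{2}\right\rceil$.
   Context: All graphs are finite, undirected, without loops or multiple edges; $|G|$ denotes the number of vertices of $G$. A graph $G$ admits an equitable $k$-tree-coloring if $V(G)$ can be partitioned into $k$ subsets, each of size $\lceil |G|/k\rceil$ or $\lfloor |G|/k\rfloor$, such that each subset induces a forest in $G$. The equitable vertex arboricity $a_{eq}(G)$ is the minimum integer $k$ such that $G$ has an equitable $k$-tree-coloring. *)

theory Defs
  imports Complex_Main "HOL-Library.Disjoint_Sets" "Graph_Theory.Graph_Theory"
begin

(* Finite simple graphs are the finite, symmetric, loop-free digraphs without parallel arcs of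
   the locale graph: the undirected edge uv is the pair of arcs u -> v and v -> u.  Hence every
   edge gives a directed cycle u, v, u of length 2, and the library predicate forest, which
   forbids all directed cycles, would only hold for edgeless graphs.  The cycles of the
   undirected graph are the directed cycles of length at least 3. *)

definition undirected_cycle :: "('a, 'b) pre_digraph \<Rightarrow> 'b awalk \<Rightarrow> bool" where
  "undirected_cycle G p \<longleftrightarrow> pre_digraph.cycle G p \<and> 3 \<le> length p"

definition undirected_forest :: "('a, 'b) pre_digraph \<Rightarrow> bool" where
  "undirected_forest G \<longleftrightarrow> \<not> (\<exists>p. undirected_cycle G p)"

(* By symmetry the out-degree of a vertex is its number of neighbours. *)
definition max_degree :: "('a, 'b) pre_digraph \<Rightarrow> nat" where
  "max_degree G = (if verts G = {} then 0 else Max (out_degree G ` verts G))"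

(* The parts are indexed by {..<k}, so that they may be empty when k exceeds the number of
   vertices (the floor is then 0). *)
definition equitable_tree_coloring ::
  "('a, 'b) pre_digraph \<Rightarrow> nat \<Rightarrow> (nat \<Rightarrow> 'a set) \<Rightarrow> bool" where
  "equitable_tree_coloring G k V \<longleftrightarrow>
     (\<Union>i<k. V i) = verts G \<and>
     disjoint_family_on V {..<k} \<and>
     (\<forall>i<k. int (card (V i)) = \<lceil>real (card (verts G)) / real k\<rceil> \<or>
            int (card (V i)) = \<lfloor>real (card (verts G)) / real k\<rfloor>) \<and>
     (\<forall>i<k. undirected_forest (G \<restriction> V i))"

definition equitably_tree_colorable :: "('a, 'b) pre_digraph \<Rightarrow> nat \<Rightarrow> bool" where
  "equitably_tree_colorable G k \<longleftrightarrow> 1 \<le> k \<and> (\<exists>V. equitable_tree_coloring G k V)"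

definition equitable_vertex_arboricity :: "('a, 'b) pre_digraph \<Rightarrow> nat" where
  "equitable_vertex_arboricity G = (LEAST k. equitably_tree_colorable G k)"

lemma (in wf_digraph) undirected_forest_card_le_2:
  assumes "finite S" "card S \<le> 2"
  shows "undirected_forest (G \<restriction> S)"
  unfolding undirected_forest_def
proof
  interpret H: wf_digraph "G \<restriction> S" by (rule wellformed_induce_subgraph)
  assume "\<exists>p. undirected_cycle (G \<restriction> S) p"
  then obtain p u where p: "H.awalk u p u" "distinct (tl (H.awalk_verts u p))" "3 \<le> length p"
    by (auto simp: undirected_cycle_def H.cycle_def)
  have "set (H.awalk_verts u p) \<subseteq> S"
    using H.awalk_verts_in_verts p(1) by (auto simp: H.awalk_def)
  then have sub: "set (tl (H.awalk_verts u p)) \<subseteq> S"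
    by (cases "H.awalk_verts u p") auto
  have "length p = card (set (tl (H.awalk_verts u p)))"
    using p(2) by (simp add: distinct_card H.length_awalk_verts)
  also have "\<dots> \<le> card S" using sub assms(1) by (rule card_mono[rotated])
  finally show False using p(3) assms(2) by simp
qed

text \<open>The minimum in the definition of the equitable vertex arboricity is always attained.\<close>

lemma (in fin_digraph) equitably_tree_colorable_exists: "\<exists>k. equitably_tree_colorable G k"
proof (cases "verts G = {}")
  case True
  then have "equitable_tree_coloring G 1 (\<lambda>_. {})"
    by (auto simp: equitable_tree_coloring_def disjoint_family_on_def
        intro: undirected_forest_card_le_2)
  then show ?thesis unfolding equitably_tree_colorable_def by blast
next
  case False
  define n where "n = card (verts G)"
  have n: "1 \<le> n" using False by (simp add: n_def Suc_le_eq card_gt_0_iff)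
  obtain h where h: "bij_betw h {0..<n} (verts G)"
    using ex_bij_betw_nat_finite[OF finite_verts] n_def by blast
  have "equitable_tree_coloring G n (\<lambda>i. {h i})"
    unfolding equitable_tree_coloring_def
  proof (intro conjI allI impI)
    show "(\<Union>i<n. {h i}) = verts G"
      using h by (auto simp: bij_betw_def atLeast0LessThan)
    show "disjoint_family_on (\<lambda>i. {h i}) {..<n}"
      using h by (auto simp: disjoint_family_on_def bij_betw_def inj_on_def)
  next
    fix i
    show "int (card {h i}) = \<lceil>real (card (verts G)) / real n\<rceil> \<or>
          int (card {h i}) = \<lfloor>real (card (verts G)) / real n\<rfloor>"
      using n False by (simp add: n_def)
    show "undirected_forest (G \<restriction> {h i})" by (rule undirected_forest_card_le_2) auto
  qed
  then show ?thesis using n unfolding equitably_tree_colorable_def by blast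
qed

end

theory Submission
  imports Defs
begin

text \<open>Let \<open>n\<close> be the number of vertices and \<open>k = \<lceil>(\<Delta> + 1) / 2\<rceil>\<close>; the hypothesis gives
  \<open>n \<le> 3 k\<close>.  If \<open>n \<le> 2 k\<close>, equitable parts have at most two vertices and there is nothing to do.
  Otherwise put \<open>t = n - 2 k\<close>.  We need \<open>t\<close> parts of size three that are not triangles, the other
  \<open>k - t\<close> parts being pairs, so it suffices to find \<open>t\<close> disjoint edges in the complement of the
  graph and to complete them by arbitrary vertices.  As \<open>\<Delta> \<le> 2 k - 1\<close>, the complement has minimum
  degree at least \<open>t\<close>, and a graph with minimum degree at least \<open>t\<close> on at least \<open>2 t\<close> vertices has a
  matching of size \<open>t\<close>.\<close>

section \<open>Matchings in a symmetric relation on a finite set\<close>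

text \<open>The relation \<open>R\<close> is left arbitrary because it will be non-adjacency in
  \<open>G\<close>: this gives matchings of the complement without constructing the complement as a
  digraph.\<close>

definition matching_on :: "'a set \<Rightarrow> ('a \<Rightarrow> 'a \<Rightarrow> bool) \<Rightarrow> 'a set set \<Rightarrow> bool" where
  "matching_on V R M \<longleftrightarrow> finite M \<and> disjoint M \<and>
     (\<forall>e\<in>M. \<exists>u v. e = {u, v} \<and> u \<noteq> v \<and> u \<in> V \<and> v \<in> V \<and> R u v)"

lemma matching_on_card_Union:
  assumes "matching_on V R M"
  shows "card (\<Union>M) = 2 * card M"
proof -
  have card2: "card e = 2" if "e \<in> M" for e
    using assms that unfolding matching_on_def by (metis card_2_iff)
  have "card (\<Union>M) = (\<Sum>e\<in>M. card e)"
    by (rule card_Union_disjoint) (use assms in \<open>auto simp: matching_on_def dest!: bspec\<close>)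
  then show ?thesis using card2 by simp
qed

lemma matching_on_insert:
  assumes "matching_on V R M" "u \<noteq> v" "u \<in> V" "v \<in> V" "R u v" "{u, v} \<inter> \<Union>M = {}"
  shows "matching_on V R (insert {u, v} M)" "{u, v} \<notin> M"
proof -
  show "{u, v} \<notin> M" using assms(6) by auto
  have "disjoint (insert {u, v} M)"
    using assms(1,6) unfolding matching_on_def
    by (subst pairwise_insert) (auto simp: disjnt_def)
  moreover have "\<forall>e\<in>insert {u, v} M. \<exists>u v. e = {u, v} \<and> u \<noteq> v \<and> u \<in> V \<and> v \<in> V \<and> R u v"
    using assms(1-5) unfolding matching_on_def by blast
  ultimately show "matching_on V R (insert {u, v} M)"
    using assms(1) unfolding matching_on_def by blast
qed

lemma matching_on_Diff:
  assumes "matching_on V R M"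
  shows "matching_on V R (M - N)"
  using assms unfolding matching_on_def by (auto intro: pairwise_subset)

text \<open>Two unmatched vertices send more than \<open>2 |M|\<close> edges into the matched ones if they cannot be
  used to enlarge \<open>M\<close> directly, so three of these edges meet the same edge of \<open>M\<close>, which yields an
  augmenting path of length three.\<close>

lemma matching_on_augment:
  fixes R :: "'a \<Rightarrow> 'a \<Rightarrow> bool"
  assumes fin: "finite V" and sym: "\<And>u v. R u v \<Longrightarrow> R v u" and irrefl: "\<And>u. \<not> R u u"
    and deg: "\<And>u. u \<in> V \<Longrightarrow> card M < card {v \<in> V. R u v}"
    and card: "2 * card M + 2 \<le> card V"
    and M: "matching_on V R M"
  shows "\<exists>M'. matching_on V R M' \<and> card M' = Suc (card M)"
proof -
  have finM: "finite M" using M by (simp add: matching_on_def)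
  have sub: "\<Union>M \<subseteq> V" using M by (fastforce simp: matching_on_def)
  have "2 \<le> card (V - \<Union>M)"
    using card sub fin matching_on_card_Union[OF M]
    by (subst card_Diff_subset) (auto intro: finite_subset)
  then obtain P where "P \<subseteq> V - \<Union>M" "card P = 2" by (meson obtain_subset_with_card_n)
  then obtain x y where xy: "x \<noteq> y" "x \<in> V" "y \<in> V" "x \<notin> \<Union>M" "y \<notin> \<Union>M"
    by (auto simp: card_2_iff)
  show ?thesis
  proof (cases "\<exists>u v. u \<in> V - \<Union>M \<and> v \<in> V - \<Union>M \<and> R u v")
    case True
    then obtain u v where uv: "u \<in> V - \<Union>M" "v \<in> V - \<Union>M" "R u v" by blast
    moreover have "u \<noteq> v" using uv(3) irrefl by blast
    ultimately show ?thesis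
      using matching_on_insert[OF M, of u v] finM by (intro exI[of _ "insert {u, v} M"]) auto
  next
    case False
    define N where "N z = {v \<in> V. R z v}" for z
    have finN: "finite (N z)" for z using fin by (simp add: N_def)
    have count: "card (N z) = (\<Sum>e\<in>M. card (N z \<inter> e))" if "z \<in> V" "z \<notin> \<Union>M" for z
    proof -
      \<comment> \<open>No two unmatched vertices are related in this case, so every neighbour of
        the unmatched vertex \<open>z\<close> lies on an edge of \<open>M\<close>.\<close>
      have "N z = (\<Union>e\<in>M. N z \<inter> e)" using False that unfolding N_def by blast
      then have "card (N z) = card (\<Union>e\<in>M. N z \<inter> e)" by simp
      also have "\<dots> = (\<Sum>e\<in>M. card (N z \<inter> e))"
      proof (rule card_UN_disjoint)
        show "\<forall>e\<in>M. \<forall>e'\<in>M. e \<noteq> e' \<longrightarrow> (N z \<inter> e) \<inter> (N z \<inter> e') = {}"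
          using M by (fastforce simp: matching_on_def disjoint_def)
      qed (use finM finN in auto)
      finally show ?thesis .
    qed
    have "\<exists>e\<in>M. 2 < card (N x \<inter> e) + card (N y \<inter> e)"
    proof (rule ccontr)
      assume "\<not> ?thesis"
      then have "(\<Sum>e\<in>M. card (N x \<inter> e) + card (N y \<inter> e)) \<le> (\<Sum>e\<in>M. 2)"
        by (intro sum_mono) (auto simp: not_less)
      then have "card (N x) + card (N y) \<le> 2 * card M"
        using count xy by (simp add: sum.distrib)
      then show False using deg[OF xy(2)] deg[OF xy(3)] by (simp add: N_def)
    qed
    then obtain e where e: "e \<in> M" "2 < card (N x \<inter> e) + card (N y \<inter> e)" by blast
    then obtain a b where ab: "e = {a, b}" "a \<noteq> b" "a \<in> V" "b \<in> V"
      using M by (auto simp: matching_on_def)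
    \<comment> \<open>At least three of the four pairs between \<open>{x, y}\<close> and
      \<open>{a, b}\<close> are related. The possibly missing pair spoils only one of the two ways
      to match \<open>x\<close> and \<open>y\<close> with \<open>a\<close> and
      \<open>b\<close>.\<close>
    have "\<exists>u v. e = {u, v} \<and> u \<noteq> v \<and> R x u \<and> R y v"
    proof -
      have "card (N z \<inter> e) = (if R z a then 1 else 0) + (if R z b then 1 else 0)" for z
        using ab by (auto simp: N_def Int_insert_right)
      then have "R x a \<and> R y b \<or> R x b \<and> R y a" using e(2) by (auto split: if_splits)
      then show ?thesis using ab by (metis doubleton_eq_iff)
    qed
    then obtain u v where uv: "e = {u, v}" "u \<noteq> v" "R x u" "R y v" by blast
    have V: "u \<in> V" "v \<in> V" using uv(1) e(1) sub by auto
    have out: "u \<notin> \<Union>(M - {e})" "v \<notin> \<Union>(M - {e})"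
      using M e(1) uv(1) by (fastforce simp: matching_on_def disjoint_def)+
    have ne: "x \<noteq> u" "x \<noteq> v" "y \<noteq> u" "y \<noteq> v" using xy e(1) uv(1) by auto
    \<comment> \<open>The edge \<open>e\<close> is exchanged for \<open>{x, u}\<close>, which keeps
      the size; adding \<open>{y, v}\<close> then gains one.\<close>
    define M1 where "M1 = insert {x, u} (M - {e})"
    have M1: "matching_on V R M1" "{x, u} \<notin> M - {e}"
      unfolding M1_def
      using matching_on_insert[OF matching_on_Diff[OF M, of "{e}"], of x u] xy V out ne uv by auto
    have M2: "matching_on V R (insert {y, v} M1)" "{y, v} \<notin> M1"
      using matching_on_insert[OF M1(1), of y v] xy V out ne uv by (auto simp: M1_def)
    have "card M1 = Suc (card (M - {e}))" unfolding M1_def using M1(2) finM by simp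
    also have "\<dots> = card M" using finM e(1) by (rule card_Suc_Diff1)
    finally have "card (insert {y, v} M1) = Suc (card M)"
      using M2(2) finM by (simp add: M1_def)
    then show ?thesis using M2(1) by blast
  qed
qed

text \<open>Induction on \<open>t\<close>: the hypotheses for \<open>Suc t\<close> imply those for
  \<open>t\<close>, and they are just what is required to augment a matching of size
  \<open>t\<close>.\<close>

lemma matching_on_exists:
  fixes R :: "'a \<Rightarrow> 'a \<Rightarrow> bool"
  assumes "finite V" "\<And>u v. R u v \<Longrightarrow> R v u" "\<And>u. \<not> R u u"
    and deg: "\<And>u. u \<in> V \<Longrightarrow> t \<le> card {v \<in> V. R u v}"
    and card: "2 * t \<le> card V"
  shows "\<exists>M. matching_on V R M \<and> card M = t"
  using deg card
proof (induction t)
  case 0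
  show ?case by (rule exI[of _ "{}"]) (simp add: matching_on_def)
next
  case (Suc t)
  have "\<exists>M. matching_on V R M \<and> card M = t"
  proof (rule Suc.IH)
    show "t \<le> card {v \<in> V. R u v}" if "u \<in> V" for u using Suc.prems(1)[OF that] by simp
  qed (use Suc.prems in simp)
  then obtain M where M: "matching_on V R M" "card M = t" by blast
  have "\<exists>M'. matching_on V R M' \<and> card M' = Suc (card M)"
  proof (rule matching_on_augment[OF assms(1-3)])
    show "card M < card {v \<in> V. R u v}" if "u \<in> V" for u
      using Suc.prems(1)[OF that] M(2) by simp
  qed (use Suc.prems M in auto)
  then show ?case using M(2) by simp
qed

section \<open>Partitions with prescribed part sizes\<close>

text \<open>A set of the last prescribed size is cut off, and the induction hypothesis partitions
  the rest.\<close>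

lemma partition_with_cards_exists:
  fixes s :: "nat \<Rightarrow> nat"
  assumes "finite W" "card W = (\<Sum>i<k. s i)"
  shows "\<exists>A. (\<Union>i<k. A i) = W \<and> disjoint_family_on A {..<k} \<and> (\<forall>i<k. card (A i) = s i)"
  using assms
proof (induction k arbitrary: W)
  case 0
  then show ?case by (auto simp: disjoint_family_on_def)
next
  case (Suc k)
  then obtain T where T: "T \<subseteq> W" "card T = s k"
    by (metis obtain_subset_with_card_n le_add2 sum.lessThan_Suc)
  have finT: "finite T" using T(1) Suc.prems(1) by (rule finite_subset)
  have "card (W - T) = (\<Sum>i<k. s i)" using T finT Suc.prems(2) by (simp add: card_Diff_subset)
  then obtain A where A: "(\<Union>i<k. A i) = W - T" "disjoint_family_on A {..<k}" "\<forall>i<k. card (A i) = s i"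
    using Suc.IH[of "W - T"] Suc.prems(1) by blast
  have sub: "A i \<inter> T = {}" if "i < k" for i using A(1) that by blast
  have "(\<Union>i<Suc k. (A(k := T)) i) = (\<Union>i<k. A i) \<union> T"
    by (auto simp: lessThan_Suc)
  then have "(\<Union>i<Suc k. (A(k := T)) i) = W" using A(1) T(1) by auto
  moreover have "disjoint_family_on (A(k := T)) {..<Suc k}"
    unfolding disjoint_family_on_def
  proof (intro ballI impI)
    fix i j assume "i \<in> {..<Suc k}" "j \<in> {..<Suc k}" "i \<noteq> j"
    then show "(A(k := T)) i \<inter> (A(k := T)) j = {}"
      using disjoint_family_onD[OF A(2), of i j] sub[of i] sub[of j] by (auto simp: less_Suc_eq)
  qed
  moreover have "\<forall>i<Suc k. card ((A(k := T)) i) = s i"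
    using A(3) T(2) by (auto simp: less_Suc_eq)
  ultimately show ?case by blast
qed

section \<open>Triples that are not triangles, and degrees in the complement\<close>

text \<open>A cycle of length at least three inside three vertices visits all of them, so it is a
  triangle and has an arc between \<open>u\<close> and \<open>v\<close> in one direction; by
  symmetry \<open>(u, v)\<close> is then an arc.\<close>

lemma undirected_forest_nonadjacent_triple:
  assumes "graph G" and nadj: "(u, v) \<notin> arcs_ends G"
    and S: "finite S" "card S = 3" "u \<in> S" "v \<in> S" "u \<noteq> v"
  shows "undirected_forest (G \<restriction> S)"
  unfolding undirected_forest_def
proof
  interpret graph G by fact
  interpret H: wf_digraph "G \<restriction> S" by (rule wellformed_induce_subgraph)
  assume "\<exists>p. undirected_cycle (G \<restriction> S) p"
  then obtain p w where p: "H.awalk w p w" "distinct (tl (H.awalk_verts w p))" "3 \<le> length p"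
    by (auto simp: undirected_cycle_def H.cycle_def)
  have "set (H.awalk_verts w p) \<subseteq> S"
    using H.awalk_verts_in_verts p(1) by (auto simp: H.awalk_def)
  \<comment> \<open>The closed walk lists \<open>w\<close> at both ends; its tail lists each vertex
    of the cycle once.\<close>
  then have sub: "set (tl (H.awalk_verts w p)) \<subseteq> S"
    by (cases "H.awalk_verts w p") auto
  have len: "length p = card (set (tl (H.awalk_verts w p)))"
    using p(2) by (simp add: distinct_card H.length_awalk_verts)
  also have "\<dots> \<le> card S" using sub S(1) by (rule card_mono[rotated])
  finally have len3: "length p = 3" using p(3) S(2) by simp
  then have all: "set (tl (H.awalk_verts w p)) = S"
    using len sub S(1,2) by (metis card_subset_eq)
  obtain a b c where abc: "p = [a, b, c]"
    using len3 by (auto simp: numeral_3_eq_3 length_Suc_conv)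
  have arcs: "a \<in> arcs G" "b \<in> arcs G" "c \<in> arcs G"
    using p(1) by (auto simp: H.awalk_def abc)
  have ends: "tail G a = w" "head G a = tail G b" "head G b = tail G c" "head G c = w"
    using p(1) by (auto simp: H.awalk_def abc)
  have "S = {tail G b, tail G c, w}"
    using all ends by (auto simp: abc)
  moreover have "(w, tail G b) \<in> arcs_ends G" "(tail G b, tail G c) \<in> arcs_ends G"
    "(tail G c, w) \<in> arcs_ends G"
    using arcs ends by (metis in_arcs_imp_in_arcs_ends)+
  ultimately have "(u, v) \<in> arcs_ends G \<or> (v, u) \<in> arcs_ends G"
    using S(3-5) by auto
  then show False using nadj graph_symmetric by blast
qed

text \<open>Every vertex is \<open>u\<close>, an out-neighbour of \<open>u\<close> or a
  non-neighbour, and there are at most \<open>max_degree G\<close> out-neighbours. This bounds the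
  minimum degree of the complement from below.\<close>

lemma (in graph) card_nonneighbours_ge:
  assumes "u \<in> verts G"
  shows "card (verts G) \<le> card {v \<in> verts G. u \<noteq> v \<and> (u, v) \<notin> arcs_ends G} + max_degree G + 1"
proof -
  let ?N = "head G ` out_arcs G u"
  have finN: "finite (out_arcs G u)" using finite_arcs by (auto simp: out_arcs_def)
  have "verts G \<subseteq> {v \<in> verts G. u \<noteq> v \<and> (u, v) \<notin> arcs_ends G} \<union> ?N \<union> {u}"
    by (auto simp: arcs_ends_def arc_to_ends_def out_arcs_def)
  then have "card (verts G) \<le> card ({v \<in> verts G. u \<noteq> v \<and> (u, v) \<notin> arcs_ends G} \<union> ?N \<union> {u})"
    using finN finite_verts by (intro card_mono) auto
  also have "\<dots> \<le> card {v \<in> verts G. u \<noteq> v \<and> (u, v) \<notin> arcs_ends G} + card ?N + 1"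
    by (metis (no_types, lifting) add_le_mono card_Un_le is_singletonI is_singleton_altdef
        le_refl le_trans)
  also have "card ?N \<le> out_degree G u"
    unfolding out_degree_def using finN by (rule card_image_le)
  also have "out_degree G u \<le> max_degree G"
    unfolding max_degree_def using assms finite_verts by auto
  finally show ?thesis by simp
qed

section \<open>Equitable colorings with at most 2 k vertices, and with more than 2 k but at most 3
  k\<close>

lemma (in graph) equitably_tree_colorable_small_parts:
  assumes k: "1 \<le> k" and n: "card (verts G) \<le> 2 * k"
  shows "equitably_tree_colorable G k"
proof -
  let ?n = "card (verts G)"
  define s where "s i = (if i < ?n mod k then Suc (?n div k) else ?n div k)" for i
  have le: "{..<k} \<inter> {i. i < ?n mod k} = {..<?n mod k}"
    using k by (auto intro: less_trans)
  have "(\<Sum>i<k. s i) = (\<Sum>i<k. ?n div k + (if i < ?n mod k then 1 else 0))"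
    by (intro sum.cong) (auto simp: s_def)
  also have "\<dots> = ?n" using le by (simp add: sum.distrib sum.If_cases)
  finally obtain A where A: "(\<Union>i<k. A i) = verts G" "disjoint_family_on A {..<k}"
      "\<forall>i<k. card (A i) = s i"
    using partition_with_cards_exists[OF finite_verts, of s k] by auto
  have s2: "s i \<le> 2" for i
  \<comment> \<open>At equality the quotient is already 2, but the remainder is 0, so no part gets a
    third vertex. Below it the quotient is at most 1.\<close>
  proof (cases "?n = 2 * k")
    case True
    then show ?thesis using k by (simp add: s_def)
  next
    case False
    then have "?n div k < 2" using n k by (simp add: div_less_iff_less_mult)
    then show ?thesis by (simp add: s_def)
  qed
  have "equitable_tree_coloring G k A"
    unfolding equitable_tree_coloring_def
  proof (intro conjI allI impI A(1,2))
    fix i assume i: "i < k"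
    have fl: "\<lfloor>real ?n / real k\<rfloor> = int (?n div k)" by (simp add: floor_divide_of_nat_eq)
    show "int (card (A i)) = \<lceil>real ?n / real k\<rceil> \<or> int (card (A i)) = \<lfloor>real ?n / real k\<rfloor>"
    proof (cases "i < ?n mod k")
      case True
      \<comment> \<open>A positive remainder makes the quotient non-integral, so the ceiling exceeds
        the floor by one.\<close>
      have ne: "real ?n / real k \<noteq> real (?n div k)"
      proof
        assume "real ?n / real k = real (?n div k)"
        then have "real ?n = real (?n div k * k)" using k by (simp add: field_simps)
        then have "?n = ?n div k * k" by (simp only: of_nat_eq_iff)
        then show False using True by (metis mod_mult_self2_is_0 not_less_zero)
      qed
      have "\<lceil>real ?n / real k\<rceil> = int (?n div k) + 1"
        using ne fl by (simp add: ceiling_altdef)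
      then show ?thesis using A(3) i True by (simp add: s_def)
    next
      case False
      then show ?thesis using A(3) i fl by (simp add: s_def)
    qed
    have "finite (A i)" using A(1) i finite_verts by (metis UN_upper finite_subset lessThan_iff)
    then show "undirected_forest (G \<restriction> A i)"
      using A(3) i s2[of i] by (intro undirected_forest_card_le_2) auto
  qed
  then show ?thesis using k unfolding equitably_tree_colorable_def by blast
qed

lemma (in graph) equitably_tree_colorable_large_parts:
  assumes deg: "max_degree G < 2 * k"
    and n: "2 * k < card (verts G)" "card (verts G) \<le> 3 * k"
  shows "equitably_tree_colorable G k"
proof -
  let ?n = "card (verts G)"
  define t where "t = ?n - 2 * k"
  have t: "?n = 2 * k + t" "0 < t" "t \<le> k" using n by (auto simp: t_def)
  define R where "R u v \<longleftrightarrow> u \<noteq> v \<and> (u, v) \<notin> arcs_ends G" for u v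
  have "\<exists>M. matching_on (verts G) R M \<and> card M = t"
  proof (rule matching_on_exists)
    show "R v u" if "R u v" for u v
      using that by (auto simp: R_def dest: graph_symmetric)
    show "t \<le> card {v \<in> verts G. R u v}" if "u \<in> verts G" for u
      using card_nonneighbours_ge[OF that] deg t(1) by (simp add: R_def)
  qed (use t finite_verts in \<open>auto simp: R_def\<close>)
  then obtain M where M: "matching_on (verts G) R M" "card M = t" by blast
  then have finM: "finite M" by (simp add: matching_on_def)
  obtain h where h: "bij_betw h {..<t} M"
    using ex_bij_betw_nat_finite[OF finM] M(2) by (auto simp: atLeast0LessThan)
  have subM: "\<Union>M \<subseteq> verts G" using M(1) by (fastforce simp: matching_on_def)
  \<comment> \<open>\<open>s i\<close> counts the unmatched vertices put into part \<open>i\<close>: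
    one to complete a matching edge to a triple, two to form a pair. They use up the n - 2 t = 2 k -
    t vertices outside \<open>M\<close>.\<close>
  define s :: "nat \<Rightarrow> nat" where "s i = (if i < t then 1 else 2)" for i
  have sums: "(\<Sum>i<k. s i) + t = 2 * k"
  proof -
    have "{..<k} \<inter> {i. i < t} = {..<t}" "{..<k} \<inter> - {i. i < t} = {t..<k}" using t(3) by auto
    then show ?thesis using t(3) by (simp add: s_def sum.If_cases)
  qed
  have "card (verts G - \<Union>M) = ?n - 2 * t"
    using matching_on_card_Union[OF M(1)] M(2) subM finite_verts
    by (simp add: card_Diff_subset finite_subset)
  then have "card (verts G - \<Union>M) = (\<Sum>i<k. s i)" using sums t(1) by simp
  then obtain A where A: "(\<Union>i<k. A i) = verts G - \<Union>M" "disjoint_family_on A {..<k}"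
      "\<forall>i<k. card (A i) = s i"
    using partition_with_cards_exists[of "verts G - \<Union>M" s k] finite_verts by auto
  \<comment> \<open>The default \<open>{}\<close> lets every part have the form
    \<open>E i \<union> A i\<close>, with or without a matching edge.\<close>
  define E where "E i = (if i < t then h i else {})" for i
  have E_M: "E i \<subseteq> \<Union>M" for i using h by (auto simp: E_def bij_betw_def)
  have finA: "finite (A i)" if "i < k" for i
    using A(1) that finite_verts by (metis UN_upper finite_Diff finite_subset lessThan_iff)
  have AM: "A i \<inter> \<Union>M = {}" if "i < k" for i using A(1) that by blast
  have EA: "E i \<inter> A j = {}" if "j < k" for i j using E_M[of i] AM[OF that] by blast
  have pair: "\<exists>u v. E i = {u, v} \<and> R u v" if "i < t" for i
  proof -
    have "E i \<in> M" using bij_betwE[OF h] that by (simp add: E_def)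
    then show ?thesis using M(1) unfolding matching_on_def by blast
  qed
  have "(\<Union>i<k. E i) = \<Union>M"
  proof
    show "(\<Union>i<k. E i) \<subseteq> \<Union>M" using E_M by blast
    show "\<Union>M \<subseteq> (\<Union>i<k. E i)"
    proof
      fix x assume "x \<in> \<Union>M"
      then obtain i where "i < t" "x \<in> h i" using h by (auto simp: bij_betw_def)
      then show "x \<in> (\<Union>i<k. E i)" using t(3) by (auto simp: E_def)
    qed
  qed
  then have U: "(\<Union>i<k. E i \<union> A i) = verts G" using A(1) subM by (auto simp: UN_Un_distrib)
  have disjE: "E i \<inter> E j = {}" if "i \<noteq> j" for i j
  proof (cases "i < t \<and> j < t")
    case True
    then have "h i \<in> M" "h j \<in> M" "h i \<noteq> h j"
      using h that by (auto simp: bij_betw_def inj_on_def)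
    then show ?thesis using M(1) True by (auto simp: E_def matching_on_def disjoint_def)
  qed (auto simp: E_def)
  have disj: "disjoint_family_on (\<lambda>i. E i \<union> A i) {..<k}"
    unfolding disjoint_family_on_def
  proof (intro ballI impI)
    fix i j assume ij: "i \<in> {..<k}" "j \<in> {..<k}" "i \<noteq> j"
    have "A i \<inter> A j = {}" using A(2) ij by (auto simp: disjoint_family_on_def)
    then show "(E i \<union> A i) \<inter> (E j \<union> A j) = {}"
      using disjE[OF ij(3)] EA[of i j] EA[of j i] ij
      by (simp add: Int_Un_distrib Int_Un_distrib2 Int_commute)
  qed
  have card3: "card (E i \<union> A i) = 3" if "i < t" for i
  proof -
    have "E i \<inter> A i = {}" using EA that t(3) by simp
    moreover obtain u v where "E i = {u, v}" "R u v" using pair \<open>i < t\<close> by blast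
    ultimately show ?thesis
      using A(3) that t(3) finA[of i] by (subst card_Un_disjoint) (auto simp: s_def R_def)
  qed
  have card2: "card (E i \<union> A i) = 2" if "\<not> i < t" "i < k" for i
    using A(3) that by (simp add: E_def s_def)
  have fin: "finite (E i \<union> A i)" if "i < k" for i
    using U that finite_verts by (metis (no_types, lifting) UN_upper finite_subset lessThan_iff)
  have "equitable_tree_coloring G k (\<lambda>i. E i \<union> A i)"
    unfolding equitable_tree_coloring_def
  proof (intro conjI allI impI U disj)
    fix i assume i: "i < k"
    have "\<lceil>real ?n / real k\<rceil> = 3"
      using n i by (intro ceiling_unique) (auto simp: field_simps)
    \<comment> \<open>A part with \<open>\<not> i < t\<close> exists only if \<open>t < k\<close>,
      that is n < 3 k. For \<open>t = k\<close> the floor is 3 and all parts are triples.\<close>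
    moreover have "\<lfloor>real ?n / real k\<rfloor> = 2" if "\<not> i < t"
      using n i that t by (intro floor_unique) (auto simp: field_simps)
    ultimately show "int (card (E i \<union> A i)) = \<lceil>real ?n / real k\<rceil> \<or>
        int (card (E i \<union> A i)) = \<lfloor>real ?n / real k\<rfloor>"
      using card2 card3 i by (cases "i < t") auto
    show "undirected_forest (G \<restriction> (E i \<union> A i))"
    proof (cases "i < t")
      case True
      then obtain u v where "E i = {u, v}" "R u v" using pair by blast
      then show ?thesis
        using card3[OF True] fin[OF i] graph_axioms
        by (intro undirected_forest_nonadjacent_triple[of G u v]) (auto simp: R_def)
    next
      case False
      then show ?thesis using card2 fin i by (intro undirected_forest_card_le_2) auto
    qed
  qed
  then show ?thesis using n unfolding equitably_tree_colorable_def by auto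
qed

section \<open>The bound on the equitable vertex arboricity\<close>

theorem theorem2p4:
  fixes G :: "('a, 'b) pre_digraph"
  assumes "graph G"
    and "real (max_degree G) \<ge> 2 / 3 * real (card (verts G)) - 1"
  shows "int (equitable_vertex_arboricity G) \<le> \<lceil>(real (max_degree G) + 1) / 2\<rceil>"
proof -
  interpret graph G by fact
  define k where "k = nat \<lceil>(real (max_degree G) + 1) / 2\<rceil>"
  have k: "int k = \<lceil>(real (max_degree G) + 1) / 2\<rceil>" "1 \<le> k"
    by (auto simp: k_def le_nat_iff)
  then have "(real (max_degree G) + 1) / 2 \<le> real k"
    by (metis le_of_int_ceiling of_int_of_nat_eq)
  \<comment> \<open>The second bound chains 2 n / 3 \<le> \<Delta> + 1 \<le> 2 k.\<close>
  then have "real (max_degree G) < real (2 * k)" "real (card (verts G)) \<le> real (3 * k)"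
    using assms(2) by auto
  then have "max_degree G < 2 * k" "card (verts G) \<le> 3 * k"
    by (simp_all only: of_nat_less_iff of_nat_le_iff)
  then have "equitably_tree_colorable G k"
    using equitably_tree_colorable_small_parts[OF k(2)] equitably_tree_colorable_large_parts
    by (meson not_le)
  then have "equitable_vertex_arboricity G \<le> k"
    unfolding equitable_vertex_arboricity_def by (rule Least_le)
  then show ?thesis using k(1) by simp
qed

end
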